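(* Let $f(z)=\sum_{k=1}^N c_{\alpha_k}z^{\alpha_k}$ be a Laurent polynomial in $n$ variables with support $A=\{\alpha_1,\dots,\alpha_N\}\subset\mathbb{Z}^n$, whose Newton polytope has dimension $n$, and let $B$ be a dual matrix of $A$. Then the order map \[ \operatorname{co-ord}\colon \operatorname{CC}(\overline{\mathcal{LA}'}(f)) \rightarrow \operatorname{int}(\mathcal{Z}_B)\cap\big(\operatorname{Arg}_\pi(c)B+2\pi\mathbb{Z}[B]\big) \] is a surjection.
   Context: All coefficients $c_{\alpha_k}$ are nonzero complex numbers, the $\alpha_k$ are distinct, and $\mathbf{T}^n=(\mathbb{R}/2\pi\mathbb{Z})^n$. A half-space is a set $H_\phi=\{z\in\mathbb{C}\mid \Re(e^{i\phi}z)>0\}$, $\phi\in\mathbb{R}$. For $\theta\in\mathbf{T}^n$ put $f\langle\theta\rangle=[e^{i(\arg(c_{\alpha_1})+\langle\alpha_1,\theta\rangle)},\dots,e^{i(\arg(c_{\alpha_N})+\langle\alpha_N,\theta\rangle)}]$, also viewed as a subset of the unit circle. It is lopsided if there is a half-space $H$ with $f\langle\theta\rangle\subset\overline{H}$ but $f\langle\theta\rangle\not\subset\partial H$. The lopsided coamoeba $\mathcal{LA}'(f)$ is the set of $\theta\in\mathbf{T}^n$ such that $f\langle\theta\rangle$ is not lopsided; $\overline{\mathcal{LA}'}(f)$ is its closure, and $\operatorname{CC}(\overline{\mathcal{LA}'}(f))$ is the set of connected components of the complement of $\overline{\mathcal{LA}'}(f)$ in $\mathbf{T}^n$. The Newton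 polytope of $f$ is $\Delta_f=\operatorname{Conv}(A)$. Identify $A$ with the $(n+1)\times N$ integer matrix whose $k$th column is $(1,\alpha_k)^t$, and set $m=N-n-1$. A dual matrix of $A$ is an integer $N\times m$ matrix $B$ of full rank $m$ with $AB=0$; denote its rows by $b_1,\dots,b_N\in\mathbb{Z}^m$. $\mathbb{Z}[B]\subset\mathbb{Z}^m$ is the lattice generated by the rows of $B$, and $\mathcal{Z}_B=\{\sum_{j=1}^N\frac{\pi}{2}\mu_jb_j\mid |\mu_j|\le 1\}\subset\mathbb{R}^m$. $\arg_\pi\colon\mathbb{C}^*\to(-\pi,\pi]$ is the principal argument, and $\operatorname{Arg}_\pi(c)=(\arg_\pi(c_{\alpha_1}),\dots,\arg_\pi(c_{\alpha_N}))$, a row vector. For $\alpha\in A$ and $\theta\in\mathbb{R}^n$ set \[ p_\alpha^k(\theta)=\arg_\pi\Big(\frac{c_{\alpha_k}e^{i\langle\alpha_k,\theta\rangle}}{c_\alpha e^{i\langle\alpha,\theta\rangle}}\Big)-\arg_\pi(c_{\alpha_k})+\arg_\pi(c_\alpha)-\langle\alpha_k-\alpha,\theta\rangle, \] $p_\alpha(\theta)=(p_\alpha^1(\theta),\dots,p_\alpha^N(\theta))$, and $v_\alpha(\theta)=(\operatorname{Arg}_\pi(c)+p_\alpha(\theta))B\in\mathbb{R}^m$ ($2\pi$-periodic in each $\theta_i$). The order map is defined by $\operatorname{co-ord}(\Theta)=v_\alpha(\theta)$ for any $\theta\in\Theta$ and any $\alpha\in A$; this is independent of the choices of $\theta$ and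 $\alpha$ and takes values in the stated target set. *)

theory Defs
  imports "HOL-Analysis.Analysis"
begin

section \<open>The torus\<close>

quotient_type circle = real / "\<lambda>x y. \<exists>k::int. x - y = 2 * pi * of_int k"
  morphisms circle_rep circle_of
proof (rule equivpI)
  show "reflp (\<lambda>x y. \<exists>k::int. x - y = 2 * pi * of_int k)"
    by (auto intro!: reflpI exI[of _ 0])
  show "symp (\<lambda>x y. \<exists>k::int. x - y = 2 * pi * of_int k)"
  proof (rule sympI)
    fix x y :: real
    assume "\<exists>k::int. x - y = 2 * pi * of_int k"
    then obtain k :: int where "x - y = 2 * pi * of_int k" by blast
    then have "y - x = 2 * pi * of_int (- k)" by simp
    then show "\<exists>k::int. y - x = 2 * pi * of_int k" by blast
  qed
  show "transp (\<lambda>x y. \<exists>k::int. x - y = 2 * pi * of_int k)"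
  proof (rule transpI)
    fix x y z :: real
    assume "\<exists>k::int. x - y = 2 * pi * of_int k" "\<exists>k::int. y - z = 2 * pi * of_int k"
    then obtain k l :: int where "x - y = 2 * pi * of_int k" "y - z = 2 * pi * of_int l" by blast
    then have "x - z = 2 * pi * of_int (k + l)" by (simp add: algebra_simps)
    then show "\<exists>k::int. x - z = 2 * pi * of_int k" by blast
  qed
qed

text \<open>The quotient topology on \<open>\<real> / 2\<pi>\<int>\<close>.\<close>

instantiation circle :: topological_space
begin

definition open_circle :: "circle set \<Rightarrow> bool" where
  "open_circle U \<longleftrightarrow> open (circle_of -` U)"

instance
  by standard (auto simp: open_circle_def vimage_Union)

end

text \<open>The torus \<open>(\<real> / 2\<pi>\<int>)\<^sup>n\<close> carries the product topology of the library's vector type.\<close>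

type_synonym 'n torus = "circle ^ 'n"

definition torus_of :: "real ^ 'n \<Rightarrow> 'n torus" where
  "torus_of \<theta> = (\<chi> i. circle_of (\<theta> $ i))"


section \<open>Laurent polynomials and lopsided coamoebas\<close>

text \<open>
  A Laurent polynomial \<open>\<Sum>\<^sub>k c\<^sub>k z\<^bsup>\<alpha>\<^sub>k\<^esup>\<close> is given by its coefficients \<open>c\<close> and exponent vectors \<open>\<alpha>\<close>,
  both indexed by a finite type \<open>'k\<close> with \<open>N\<close> elements.
\<close>

definition real_vec :: "int ^ 'n \<Rightarrow> real ^ 'n" where
  "real_vec a = (\<chi> i. of_int (a $ i))"

definition newton_polytope :: "('k \<Rightarrow> int ^ 'n) \<Rightarrow> (real ^ 'n) set" where
  "newton_polytope \<alpha> = convex hull range (\<lambda>k. real_vec (\<alpha> k))"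

definition half_space :: "real \<Rightarrow> complex set" where
  "half_space \<phi> = {z. Re (cis \<phi> * z) > 0}"

definition phases :: "('k \<Rightarrow> complex) \<Rightarrow> ('k \<Rightarrow> int ^ 'n) \<Rightarrow> real ^ 'n \<Rightarrow> 'k \<Rightarrow> complex" where
  "phases c \<alpha> \<theta> k = cis (Arg (c k) + real_vec (\<alpha> k) \<bullet> \<theta>)"

definition lopsided :: "('k \<Rightarrow> complex) \<Rightarrow> ('k \<Rightarrow> int ^ 'n) \<Rightarrow> real ^ 'n \<Rightarrow> bool" where
  "lopsided c \<alpha> \<theta> \<longleftrightarrow>
     (\<exists>\<phi>. range (phases c \<alpha> \<theta>) \<subseteq> closure (half_space \<phi>) \<and>
          \<not> range (phases c \<alpha> \<theta>) \<subseteq> frontier (half_space \<phi>))"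

definition lopsided_coamoeba :: "('k \<Rightarrow> complex) \<Rightarrow> ('k \<Rightarrow> int ^ 'n) \<Rightarrow> 'n torus set" where
  "lopsided_coamoeba c \<alpha> = torus_of ` {\<theta>. \<not> lopsided c \<alpha> \<theta>}"

definition CC :: "('k \<Rightarrow> complex) \<Rightarrow> ('k \<Rightarrow> int ^ 'n) \<Rightarrow> 'n torus set set" where
  "CC c \<alpha> = components (- closure (lopsided_coamoeba c \<alpha>))"


section \<open>Dual matrices\<close>

text \<open>The row with index \<open>None\<close> is the row of ones, so that the \<open>k\<close>th column is \<open>(1, \<alpha>\<^sub>k)\<^sup>t\<close>.\<close>

definition exponent_matrix :: "('k \<Rightarrow> int ^ 'n) \<Rightarrow> int ^ 'k ^ ('n option)" where
  "exponent_matrix \<alpha> = (\<chi> r k. case r of None \<Rightarrow> 1 | Some i \<Rightarrow> \<alpha> k $ i)"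

text \<open>
  Since \<open>m = 0\<close> occurs (when the Newton polytope is a simplex with no further exponents),
  \<open>\<real>\<^sup>m\<close> is the library's \<^term>\<open>Euclidean_space m\<close>, whose points are the sequences
  vanishing from index \<open>m\<close> on. Accordingly an \<open>N \<times> m\<close> matrix is a family \<open>B\<close> of rows, with entry
  \<open>B k j\<close> in row \<open>k\<close> and column \<open>j < m\<close>, and \<open>B k j = 0\<close> for \<open>j \<ge> m\<close>.
  The rank is the dimension of the span of the columns.
\<close>

definition matrix_column :: "('k \<Rightarrow> nat \<Rightarrow> int) \<Rightarrow> nat \<Rightarrow> int ^ 'k" where
  "matrix_column B j = (\<chi> k. B k j)"

definition dual_matrix :: "('k::finite \<Rightarrow> int ^ 'n) \<Rightarrow> nat \<Rightarrow> ('k \<Rightarrow> nat \<Rightarrow> int) \<Rightarrow> bool" where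
  "dual_matrix \<alpha> m B \<longleftrightarrow>
     (\<forall>k. \<forall>j\<ge>m. B k j = 0) \<and>
     dim ((\<lambda>j. real_vec (matrix_column B j)) ` {..<m}) = m \<and>
     (\<forall>j<m. exponent_matrix \<alpha> *v matrix_column B j = 0)"

definition row_mult :: "('k::finite \<Rightarrow> real) \<Rightarrow> ('k \<Rightarrow> nat \<Rightarrow> int) \<Rightarrow> nat \<Rightarrow> real" where
  "row_mult x B = (\<lambda>j. \<Sum>k\<in>UNIV. x k * of_int (B k j))"

definition row_lattice :: "('k::finite \<Rightarrow> nat \<Rightarrow> int) \<Rightarrow> (nat \<Rightarrow> real) set" where
  "row_lattice B = {row_mult (\<lambda>k. of_int (l k)) B | l :: 'k \<Rightarrow> int. True}"

definition zonotope :: "('k::finite \<Rightarrow> nat \<Rightarrow> int) \<Rightarrow> (nat \<Rightarrow> real) set" where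
  "zonotope B = {row_mult (\<lambda>k. pi / 2 * \<mu> k) B | \<mu>. \<forall>k. \<bar>\<mu> k\<bar> \<le> 1}"


section \<open>The order map\<close>

text \<open>The fixed exponent \<open>\<alpha> \<in> A\<close> of the order map is given by its index \<open>a\<close>.\<close>

definition p_coord ::
    "('k \<Rightarrow> complex) \<Rightarrow> ('k \<Rightarrow> int ^ 'n) \<Rightarrow> 'k \<Rightarrow> real ^ 'n \<Rightarrow> 'k \<Rightarrow> real" where
  "p_coord c \<alpha> a \<theta> k =
     Arg ((c k * cis (real_vec (\<alpha> k) \<bullet> \<theta>)) / (c a * cis (real_vec (\<alpha> a) \<bullet> \<theta>)))
       - Arg (c k) + Arg (c a) - real_vec (\<alpha> k - \<alpha> a) \<bullet> \<theta>"

definition v_map ::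
    "('k::finite \<Rightarrow> complex) \<Rightarrow> ('k \<Rightarrow> int ^ 'n) \<Rightarrow> ('k \<Rightarrow> nat \<Rightarrow> int) \<Rightarrow> 'k \<Rightarrow> real ^ 'n
      \<Rightarrow> nat \<Rightarrow> real" where
  "v_map c \<alpha> B a \<theta> = row_mult (\<lambda>k. Arg (c k) + p_coord c \<alpha> a \<theta> k) B"

text \<open>
  The common value of \<^term>\<open>v_map c \<alpha> B a \<theta>\<close> over all indices \<open>a\<close> and all representatives \<open>\<theta>\<close> of
  points of \<open>\<Theta>\<close>.
\<close>

definition co_ord ::
    "('k::finite \<Rightarrow> complex) \<Rightarrow> ('k \<Rightarrow> int ^ 'n) \<Rightarrow> ('k \<Rightarrow> nat \<Rightarrow> int) \<Rightarrow> 'n torus set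
      \<Rightarrow> nat \<Rightarrow> real" where
  "co_ord c \<alpha> B \<Theta> = (THE v. \<forall>\<theta> a. torus_of \<theta> \<in> \<Theta> \<longrightarrow> v_map c \<alpha> B a \<theta> = v)"

definition order_target ::
    "('k::finite \<Rightarrow> complex) \<Rightarrow> nat \<Rightarrow> ('k \<Rightarrow> nat \<Rightarrow> int) \<Rightarrow> (nat \<Rightarrow> real) set" where
  "order_target c m B =
     (Euclidean_space m interior_of zonotope B) \<inter>
     {\<lambda>j. row_mult (\<lambda>k. Arg (c k)) B j + 2 * pi * w j | w. w \<in> row_lattice B}"

end

theory Submission imports Defs begin

text \<open>
  A point \<open>\<theta>\<close> lies off the closed lopsided coamoeba iff all phases lie in one open half-plane, that
  is, iff their arguments have lifts \<open>Arg c\<^sub>k + \<langle>\<alpha>\<^sub>k, \<theta>\<rangle> + 2\<pi> n\<^sub>k = \<phi> + t\<^sub>k\<close> with \<open>\<bar>t\<^sub>k\<bar> < \<pi>/2\<close>. As the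
  row space of \<open>A\<close> is killed by \<open>B\<close>, the order map has the value \<open>(Arg c + 2\<pi> n)B = tB\<close> there; it
  is locally constant because \<open>n\<close> is, and it is interior to the zonotope because \<open>t\<close> is interior to
  the cube. Conversely, an interior point \<open>(Arg c + 2\<pi> n)B\<close> of the zonotope equals \<open>tB\<close> with
  \<open>\<bar>t\<^sub>k\<bar> < \<pi>/2\<close>, and since the left kernel of \<open>B\<close> is exactly the row space of \<open>A\<close>, the difference
  \<open>Arg c + 2\<pi> n - t\<close> has the form \<open>\<phi> - \<langle>\<alpha>\<^sub>k, \<theta>\<rangle>\<close>, which provides the point \<open>\<theta>\<close>.
\<close>

section \<open>The quotient map onto the torus\<close>

lemma circle_of_eq_iff: "circle_of x = circle_of y \<longleftrightarrow> (\<exists>k::int. x - y = 2 * pi * of_int k)"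
  by (simp add: circle.abs_eq_iff)

lemma surj_circle_of: "\<exists>x. circle_of x = y"
  by (metis Quotient3_abs_rep[OF Quotient3_circle])

text \<open>The preimage of the image is the union of the translates of \<open>U\<close> by the
  integer multiples of 2 pi, and each translate is open.\<close>

lemma open_circle_of_image:
  assumes "open U"
  shows "open (circle_of ` U)"
proof -
  have "circle_of -` (circle_of ` U) = (\<Union>k::int. (+) (2 * pi * of_int k) ` U)"
  proof (intro set_eqI iffI)
    fix x assume "x \<in> circle_of -` (circle_of ` U)"
    then obtain u k where "u \<in> U" "x - u = 2 * pi * of_int k"
      by (auto simp: circle_of_eq_iff)
    then show "x \<in> (\<Union>k::int. (+) (2 * pi * of_int k) ` U)"
      by (auto intro!: exI[of _ k] image_eqI[of _ _ u])
  next
    fix x assume "x \<in> (\<Union>k::int. (+) (2 * pi * of_int k) ` U)"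
    then obtain u k where "u \<in> U" "x = 2 * pi * of_int k + u" by auto
    then show "x \<in> circle_of -` (circle_of ` U)"
      by (auto simp: circle_of_eq_iff intro!: image_eqI[of _ _ u])
  qed
  then show ?thesis
    using assms by (auto simp: open_circle_def open_translation)
qed

lemma surj_torus_of: obtains \<theta> where "torus_of \<theta> = x"
proof -
  obtain f where "\<And>i. circle_of (f i) = x $ i"
    using choice[OF allI[OF surj_circle_of]] by blast
  then have "torus_of (\<chi> i. f i) = x"
    by (simp add: torus_of_def)
  then show ?thesis by (rule that)
qed

lemma torus_of_eqD:
  assumes "torus_of \<theta> = torus_of \<theta>'"
  obtains z :: "int ^ 'n::finite" where "\<theta> = \<theta>' + (2 * pi) *\<^sub>R real_vec z"
proof -
  have "\<exists>k::int. \<theta> $ i - \<theta>' $ i = 2 * pi * of_int k" for i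
    using assms by (auto simp: torus_of_def vec_eq_iff circle_of_eq_iff)
  then obtain z :: "'n \<Rightarrow> int" where "\<And>i. \<theta> $ i - \<theta>' $ i = 2 * pi * of_int (z i)"
    by metis
  then have "\<theta> = \<theta>' + (2 * pi) *\<^sub>R real_vec (\<chi> i. z i)"
    by (simp add: vec_eq_iff real_vec_def algebra_simps)
  then show ?thesis by (rule that)
qed

text \<open>The torus carries the product topology, so openness is checked on boxes: a box around a
  point of \<open>U\<close> maps onto the box formed by the images of its sides.\<close>

lemma open_torus_of_image:
  fixes U :: "(real ^ 'n::finite) set"
  assumes "open U"
  shows "open (torus_of ` U)"
  unfolding open_vec_def
proof
  fix x assume "x \<in> torus_of ` U"
  then obtain \<theta> where \<theta>: "\<theta> \<in> U" "x = torus_of \<theta>" by blast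
  have "\<exists>A. (\<forall>i. open (A i) \<and> \<theta> $ i \<in> A i) \<and> (\<forall>y. (\<forall>i. y $ i \<in> A i) \<longrightarrow> y \<in> U)"
    using assms \<theta>(1) by (simp add: open_vec_def)
  then obtain A where A: "\<forall>i. open (A i) \<and> \<theta> $ i \<in> A i" "\<forall>y. (\<forall>i. y $ i \<in> A i) \<longrightarrow> y \<in> U"
    by (elim exE conjE)
  have "y \<in> torus_of ` U" if y: "\<forall>i. y $ i \<in> circle_of ` A i" for y
  proof -
    obtain f where f: "\<And>i. f i \<in> A i" "\<And>i. y $ i = circle_of (f i)"
      using y by (simp add: image_iff) metis
    then have "y = torus_of (\<chi> i. f i)"
      by (simp add: torus_of_def vec_eq_iff)
    then show ?thesis
      using f(1) A(2) by auto
  qed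
  then show "\<exists>A. (\<forall>i. open (A i) \<and> x $ i \<in> A i) \<and> (\<forall>y. (\<forall>i. y $ i \<in> A i) \<longrightarrow> y \<in> torus_of ` U)"
    using A \<theta> by (intro exI[of _ "\<lambda>i. circle_of ` A i"]) (auto simp: torus_of_def open_circle_of_image)
qed

lemma open_torus_of_vimage:
  fixes V :: "'n::finite torus set"
  assumes "open V"
  shows "open (torus_of -` V)"
  unfolding open_vec_def
proof
  fix \<theta> assume "\<theta> \<in> torus_of -` V"
  then have "\<exists>A. (\<forall>i. open (A i) \<and> torus_of \<theta> $ i \<in> A i) \<and> (\<forall>y. (\<forall>i. y $ i \<in> A i) \<longrightarrow> y \<in> V)"
    using assms by (simp add: open_vec_def)
  then obtain A where "\<forall>i. open (A i) \<and> torus_of \<theta> $ i \<in> A i" "\<forall>y. (\<forall>i. y $ i \<in> A i) \<longrightarrow> y \<in> V"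
    by (elim exE conjE)
  then show "\<exists>A. (\<forall>i. open (A i) \<and> \<theta> $ i \<in> A i) \<and> (\<forall>y. (\<forall>i. y $ i \<in> A i) \<longrightarrow> y \<in> torus_of -` V)"
    by (intro exI[of _ "\<lambda>i. circle_of -` A i"]) (auto simp: torus_of_def open_circle_def)
qed

lemma inner_real_vec: "real_vec a \<bullet> real_vec z = of_int (\<Sum>i\<in>UNIV. a $ i * z $ i)"
  by (simp add: real_vec_def inner_vec_def)

text \<open>The exponents are integral, so a period of the torus changes every argument by a
  multiple of 2 pi.\<close>

lemma phases_torus_of:
  assumes "torus_of \<theta> = torus_of \<theta>'"
  shows "phases c \<alpha> \<theta> = phases c \<alpha> \<theta>'"
proof
  fix k
  obtain z where z: "\<theta> = \<theta>' + (2 * pi) *\<^sub>R real_vec z"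
    using torus_of_eqD[OF assms] .
  have "real_vec (\<alpha> k) \<bullet> \<theta> = real_vec (\<alpha> k) \<bullet> \<theta>' + 2 * pi * of_int (\<Sum>i\<in>UNIV. \<alpha> k $ i * z $ i)"
    by (simp add: z inner_add_right inner_real_vec del: of_int_sum)
  then show "phases c \<alpha> \<theta> k = phases c \<alpha> \<theta>' k"
    by (simp add: phases_def add.assoc[symmetric] cis_multiple_2pi del: of_int_sum flip: cis_mult)
qed


section \<open>Lopsidedness and lifted arguments\<close>

text \<open>
  The integers \<open>n k\<close> choose lifts to \<open>\<real>\<close> of the arguments of the phases, all within an open
  interval of length \<open>\<pi>\<close> around \<open>\<phi>\<close>.
\<close>

definition lifted :: "('k \<Rightarrow> complex) \<Rightarrow> ('k \<Rightarrow> int ^ 'n) \<Rightarrow> ('k \<Rightarrow> int) \<Rightarrow> real \<Rightarrow> real ^ 'n \<Rightarrow> bool" where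
  "lifted c \<alpha> n \<phi> \<theta> \<longleftrightarrow>
     (\<forall>k. \<bar>Arg (c k) + real_vec (\<alpha> k) \<bullet> \<theta> + 2 * pi * of_int (n k) - \<phi>\<bar> < pi / 2)"

text \<open>\<open>half_space \<phi>\<close> has the nonzero inner normal
  \<open>cis (- \<phi>)\<close>, so its closure and frontier arise by relaxing the strict inequality
  to a weak one and to an equality.\<close>

lemma lopsided_iff:
  "lopsided c \<alpha> \<theta> \<longleftrightarrow>
    (\<exists>\<phi>. (\<forall>k. Re (cis \<phi> * phases c \<alpha> \<theta> k) \<ge> 0) \<and> (\<exists>k. Re (cis \<phi> * phases c \<alpha> \<theta> k) > 0))"
proof -
  have h: "half_space \<phi> = {z. cis (- \<phi>) \<bullet> z > 0}" for \<phi>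
    by (simp add: half_space_def inner_complex_def)
  have "closure (half_space \<phi>) = {z. Re (cis \<phi> * z) \<ge> 0}"
    "frontier (half_space \<phi>) = {z. Re (cis \<phi> * z) = 0}" for \<phi>
    unfolding h using closure_halfspace_gt[of "cis (- \<phi>)" 0] frontier_halfspace_gt[of "cis (- \<phi>)" 0]
    by (simp_all add: inner_complex_def)
  then show ?thesis
    unfolding lopsided_def by (intro iff_exI) (auto simp: image_subset_iff less_le)
qed

lemma cos_pos_near_multiple_2pi:
  fixes x :: real
  assumes "cos x > 0"
  obtains n :: int where "\<bar>x + 2 * pi * of_int n\<bar> < pi / 2"
proof -
  define y where "y = Arg (cis x)"
  have "cis y = cis x"
    unfolding y_def by (simp add: cis_Arg sgn_div_norm)
  then obtain n :: int where n: "y = x + 2 * pi * of_int n"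
    by (metis cis.sel complex_eq_iff sin_cos_eq_iff mult.commute)
  have "cos y > 0" "\<bar>y\<bar> \<le> pi"
    using assms \<open>cis y = cis x\<close> Arg_bounded[of "cis x"]
    by (auto simp: y_def[symmetric] complex_eq_iff abs_le_iff)
  then have "\<bar>y\<bar> < pi / 2"
    using cos_monotone_0_pi_le[of "pi / 2" "\<bar>y\<bar>"] by force
  then show ?thesis using that n by blast
qed

text \<open>After rotation by \<open>\<phi>\<close> every phase has an argument within pi/2 of 0;
  undoing the rotation centres the lifts at \<open>- \<phi>\<close>.\<close>

lemma ex_lifted_if_strict:
  assumes "\<And>k. Re (cis \<phi> * phases c \<alpha> \<theta> k) > 0"
  shows "\<exists>n. lifted c \<alpha> n (- \<phi>) \<theta>"
proof -
  have "\<exists>n::int. \<bar>\<phi> + (Arg (c k) + real_vec (\<alpha> k) \<bullet> \<theta>) + 2 * pi * of_int n\<bar> < pi / 2" for k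
  proof -
    have "cos (\<phi> + (Arg (c k) + real_vec (\<alpha> k) \<bullet> \<theta>)) > 0"
      using assms[of k] by (simp add: phases_def cis_mult)
    then show ?thesis by (meson cos_pos_near_multiple_2pi)
  qed
  then obtain n :: "_ \<Rightarrow> int"
    where "\<And>k. \<bar>\<phi> + (Arg (c k) + real_vec (\<alpha> k) \<bullet> \<theta>) + 2 * pi * of_int (n k)\<bar> < pi / 2"
    by metis
  then show ?thesis
    by (intro exI[of _ n]) (simp add: lifted_def algebra_simps)
qed

lemma lifted_imp_strict:
  assumes "lifted c \<alpha> n \<phi> \<theta>"
  shows "Re (cis (- \<phi>) * phases c \<alpha> \<theta> k) > 0"
proof -
  let ?s = "Arg (c k) + real_vec (\<alpha> k) \<bullet> \<theta> + 2 * pi * of_int (n k) - \<phi>"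
  have "cos ?s > 0"
    using assms[unfolded lifted_def, rule_format, of k]
    by (intro cos_gt_zero_pi) (simp_all only: abs_less_iff, linarith+)
  moreover have "cos ?s = cos (- \<phi> + (Arg (c k) + real_vec (\<alpha> k) \<bullet> \<theta>))"
    by (subst cos_eq) (auto simp: algebra_simps intro!: exI[of _ "n k"])
  ultimately show ?thesis
    by (simp add: phases_def cis_mult)
qed

lemma open_lifted:
  fixes c :: "'k::finite \<Rightarrow> complex" and \<alpha> :: "'k \<Rightarrow> int ^ 'n::finite"
  shows "open {\<theta>. lifted c \<alpha> n \<phi> \<theta>}"
proof -
  have "{\<theta>. lifted c \<alpha> n \<phi> \<theta>} =
    (\<Inter>k. {\<theta>. \<bar>Arg (c k) + real_vec (\<alpha> k) \<bullet> \<theta> + 2 * pi * of_int (n k) - \<phi>\<bar> < pi / 2})"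
    by (auto simp: lifted_def)
  also have "open \<dots>"
    by (intro open_INT ballI finite open_Collect_less continuous_intros)
  finally show ?thesis .
qed

text \<open>With \<open>W\<close> strictly between the other two and their gap exceeding \<open>\<pi>\<close>, the origin is a
  combination with positive coefficients of the three points.\<close>

lemma no_half_plane_three_points:
  assumes "C < W" "W - C < pi" "W < A" "A - W < pi" "pi < A - C" "A - C < 2 * pi"
    and ge: "cos (\<psi> + A) \<ge> 0" "cos (\<psi> + W) \<ge> 0" "cos (\<psi> + C) \<ge> 0"
  shows False
proof -
  have p: "sin (W - C) > 0" "sin (A - W) > 0" "sin (A - C) < 0"
    using assms by (auto intro: sin_gt_zero sin_lt_zero)
  \<comment> \<open>Real part of the linear relation between three unit vectors of the plane, whose
    coefficients are their 2 by 2 determinants.\<close>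
  have "sin (W - C) * cos (\<psi> + A) - sin (A - C) * cos (\<psi> + W) + sin (A - W) * cos (\<psi> + C) = 0"
  proof -
    have eq: "W - C = (\<psi> + W) - (\<psi> + C)" "A - C = (\<psi> + A) - (\<psi> + C)" "A - W = (\<psi> + A) - (\<psi> + W)"
      by simp_all
    show ?thesis
      unfolding eq sin_diff by (simp add: algebra_simps)
  qed
  moreover have "sin (W - C) * cos (\<psi> + A) \<ge> 0" "- sin (A - C) * cos (\<psi> + W) \<ge> 0"
    "sin (A - W) * cos (\<psi> + C) \<ge> 0"
    using p ge by (auto intro!: mult_nonneg_nonneg mult_nonpos_nonneg)
  ultimately have "sin (W - C) * cos (\<psi> + A) = 0" "sin (A - C) * cos (\<psi> + W) = 0"
    by linarith+
  then have "cos (\<psi> + A) = 0" "cos (\<psi> + W) = 0"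
    using p by auto
  then have "sin (A - W) = 0"
    using sin_diff[of "\<psi> + A" "\<psi> + W"] by simp
  then show False using p by simp
qed

text \<open>
  If some closed half-plane contains the phases but no open one does, both endpoints of its
  boundary occur among the phases, with indices \<open>p \<noteq> q\<close>. Moving \<open>\<theta>\<close> along \<open>\<alpha>\<^sub>p - \<alpha>\<^sub>q\<close> pushes both
  of them out of the half-plane, and lopsidedness is lost.
\<close>

lemma interior_lopsided_strict:
  fixes c :: "'k::finite \<Rightarrow> complex" and \<alpha> :: "'k \<Rightarrow> int ^ 'n::finite"
  assumes inj: "inj \<alpha>" and int: "\<theta> \<in> interior {\<theta>. lopsided c \<alpha> \<theta>}"
  shows "\<exists>n \<phi>. lifted c \<alpha> n \<phi> \<theta>"
proof (rule ccontr)
  assume "\<not> ?thesis"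
  then have nostrict: "\<exists>k. Re (cis \<psi> * phases c \<alpha> \<theta> k) \<le> 0" for \<psi>
    by (meson ex_lifted_if_strict not_less)
  have "lopsided c \<alpha> \<theta>"
    using int interior_subset by blast
  then obtain \<phi> w where ge: "\<And>k. Re (cis \<phi> * phases c \<alpha> \<theta> k) \<ge> 0"
    and w: "Re (cis \<phi> * phases c \<alpha> \<theta> w) > 0"
    unfolding lopsided_iff by blast
  \<comment> \<open>Angles measured from the inner normal of the half-plane: all lie in
    [-pi/2, pi/2], and that of \<open>w\<close> lies strictly inside.\<close>
  define s where "s k = Arg (cis \<phi> * phases c \<alpha> \<theta> k)" for k
  have cis_s: "cis (s k) = cis \<phi> * phases c \<alpha> \<theta> k" for k
    unfolding s_def by (subst cis_Arg) (auto simp: phases_def cis_mult sgn_div_norm)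
  have s_bound: "\<bar>s k\<bar> \<le> pi" for k
    using Arg_bounded[of "cis \<phi> * phases c \<alpha> \<theta> k"] by (auto simp: s_def abs_le_iff)
  have cos_s: "cos (s k) = Re (cis \<phi> * phases c \<alpha> \<theta> k)" for k
    using cis_s[of k] by (metis cis.sel(1))
  have s_le: "\<bar>s k\<bar> \<le> pi / 2" for k
    using cos_monotone_0_pi[of "pi / 2" "\<bar>s k\<bar>"] s_bound[of k] ge[of k] cos_s[of k] by force
  have s_w: "\<bar>s w\<bar> < pi / 2"
    using s_le[of w] w cos_s[of w] cos_abs_real[of "s w"]
    by (cases "\<bar>s w\<bar> = pi / 2") (auto simp del: cos_abs_real)
  have rot: "\<exists>k. \<not> \<bar>\<delta> + s k\<bar> < pi / 2" for \<delta>
  proof -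
    obtain k where "Re (cis (\<delta> + \<phi>) * phases c \<alpha> \<theta> k) \<le> 0"
      using nostrict by blast
    moreover have "cis (\<delta> + \<phi>) * phases c \<alpha> \<theta> k = cis (\<delta> + s k)"
      by (simp add: cis_s mult.assoc flip: cis_mult)
    ultimately have "cos (\<delta> + s k) \<le> 0" by simp
    then show ?thesis
      using cos_gt_zero_pi[of "\<delta> + s k"] by (intro exI[of _ k]) (force simp only: abs_less_iff)
  qed
  have "\<exists>p. s p = pi / 2"
  proof (rule ccontr)
    assume "\<nexists>p. s p = pi / 2"
    then have lt: "s k < pi / 2" for k
      using s_le[of k] by (metis abs_le_D1 order_less_le)
    define M where "M = Max (range s)"
    have M: "M < pi / 2" "s k \<le> M" for k
      unfolding M_def using lt by (subst Max_less_iff; simp) simp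
    \<comment> \<open>The rotation is by half the gap between \<open>M\<close> and pi/2: it moves
      the lower end off -pi/2 and keeps the upper end below pi/2.\<close>
    have "\<bar>pi / 4 - M / 2 + s k\<bar> < pi / 2" for k
      using M(1) M(2)[of k] abs_le_D1[OF s_le, of k] abs_le_D2[OF s_le, of k]
      unfolding abs_less_iff by (intro conjI) linarith+
    then show False using rot by blast
  qed
  then obtain p where p: "s p = pi / 2" ..
  have "\<exists>q. s q = - (pi / 2)"
  proof (rule ccontr)
    assume "\<nexists>q. s q = - (pi / 2)"
    then have lt: "s k > - (pi / 2)" for k
      using s_le[of k] by (metis abs_le_D2 minus_le_iff order_less_le)
    define M where "M = Min (range s)"
    have M: "M > - (pi / 2)" "s k \<ge> M" for k
      unfolding M_def using lt by (subst Min_gr_iff; simp) simp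
    \<comment> \<open>The mirror image: a backward rotation by half the gap between -pi/2 and
      \<open>M\<close>.\<close>
    have "\<bar>- (pi / 4) - M / 2 + s k\<bar> < pi / 2" for k
      using M(1) M(2)[of k] abs_le_D1[OF s_le, of k] abs_le_D2[OF s_le, of k]
      unfolding abs_less_iff by (intro conjI) linarith+
    then show False using rot by blast
  qed
  then obtain q where q: "s q = - (pi / 2)" ..
  have "\<alpha> p \<noteq> \<alpha> q"
    using p q inj by (auto dest: injD)
  define \<eta> where "\<eta> = real_vec (\<alpha> p) - real_vec (\<alpha> q)"
  have "\<eta> \<noteq> 0"
    using \<open>\<alpha> p \<noteq> \<alpha> q\<close> by (auto simp: \<eta>_def real_vec_def vec_eq_iff)
  \<comment> \<open>The angle followed continuously along the line in direction
    \<open>\<eta>\<close>, without reduction modulo 2 pi.\<close>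
  define S where "S k t = s k + t * (real_vec (\<alpha> k) \<bullet> \<eta>)" for k and t :: real
  have lim: "((\<lambda>t. S k t - S l t) \<longlongrightarrow> s k - s l) (at_right 0)" for k l
    unfolding S_def by (auto intro!: tendsto_eq_intros)
  have "((\<lambda>t. \<theta> + t *\<^sub>R \<eta>) \<longlongrightarrow> \<theta>) (at_right 0)"
    by (auto intro!: tendsto_eq_intros)
  moreover have "open (interior {\<theta>. lopsided c \<alpha> \<theta>})" by simp
  ultimately have ev: "\<forall>\<^sub>F t in at_right 0. \<theta> + t *\<^sub>R \<eta> \<in> interior {\<theta>. lopsided c \<alpha> \<theta>}"
    using int topological_tendstoD by blast
  \<comment> \<open>At t = 0 the angle of \<open>w\<close> is strictly between those of
    \<open>p\<close> and \<open>q\<close>, which are pi apart, so these strict bounds persist for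
    small t.\<close>
  have "\<forall>\<^sub>F t in at_right 0. S p t - S w t < pi" "\<forall>\<^sub>F t in at_right 0. S p t - S w t > 0"
    "\<forall>\<^sub>F t in at_right 0. S w t - S q t < pi" "\<forall>\<^sub>F t in at_right 0. S w t - S q t > 0"
    "\<forall>\<^sub>F t in at_right 0. S p t - S q t < 2 * pi"
    using s_w p q pi_gt_zero unfolding abs_less_iff
    by (safe intro!: order_tendstoD[OF lim]; linarith)+
  then have "\<forall>\<^sub>F t in at_right (0::real). False"
    using ev eventually_at_right_less[of 0]
  proof eventually_elim
    case (elim t)
    have ph: "cis \<phi> * phases c \<alpha> (\<theta> + t *\<^sub>R \<eta>) k = cis (S k t)" for k
    proof -
      have "cis \<phi> * phases c \<alpha> (\<theta> + t *\<^sub>R \<eta>) k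
        = (cis \<phi> * phases c \<alpha> \<theta> k) * cis (t * (real_vec (\<alpha> k) \<bullet> \<eta>))"
        by (simp add: phases_def cis_mult inner_add_right algebra_simps)
      then show ?thesis
        by (simp add: S_def cis_s flip: cis_mult)
    qed
    \<comment> \<open>The choice of \<open>\<eta>\<close> as the difference of the two exponents
      makes the gap grow at the positive rate \<open>\<eta> \<bullet> \<eta>\<close>.\<close>
    have "S p t - S q t = pi + t * (\<eta> \<bullet> \<eta>)"
      by (simp add: S_def p q \<eta>_def inner_diff_left algebra_simps)
    then have "S p t - S q t > pi"
      using elim \<open>\<eta> \<noteq> 0\<close> by simp
    moreover
    have "lopsided c \<alpha> (\<theta> + t *\<^sub>R \<eta>)"
      using elim interior_subset by blast
    then obtain \<phi>' where \<phi>': "\<And>k. Re (cis \<phi>' * phases c \<alpha> (\<theta> + t *\<^sub>R \<eta>) k) \<ge> 0"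
      unfolding lopsided_iff by blast
    have "cos ((\<phi>' - \<phi>) + S k t) \<ge> 0" for k
    proof -
      have "cis \<phi>' * phases c \<alpha> (\<theta> + t *\<^sub>R \<eta>) k = cis (\<phi>' - \<phi>) * (cis \<phi> * phases c \<alpha> (\<theta> + t *\<^sub>R \<eta>) k)"
        by (simp add: cis_mult flip: mult.assoc)
      also have "\<dots> = cis ((\<phi>' - \<phi>) + S k t)"
        by (simp only: ph cis_mult)
      finally show ?thesis
        using \<phi>'[of k] by simp
    qed
    ultimately show False
      using elim by (intro no_half_plane_three_points[of "S q t" "S w t" "S p t" "\<phi>' - \<phi>"]) auto
  qed
  then show False by simp
qed

text \<open>Forwards, the preimage of the complement is an open set of lopsided points. Backwards,
  the set of points with given lifts is open, so its image is an open set that misses the coamoeba,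
  hence also its closure.\<close>

lemma complement_closure_lopsided_coamoeba_iff:
  fixes c :: "'k::finite \<Rightarrow> complex" and \<alpha> :: "'k \<Rightarrow> int ^ 'n::finite"
  assumes "inj \<alpha>"
  shows "torus_of \<theta> \<in> - closure (lopsided_coamoeba c \<alpha>) \<longleftrightarrow> (\<exists>n \<phi>. lifted c \<alpha> n \<phi> \<theta>)"
proof
  let ?X = "- closure (lopsided_coamoeba c \<alpha>)"
  assume "torus_of \<theta> \<in> ?X"
  moreover have "torus_of -` ?X \<subseteq> {\<theta>. lopsided c \<alpha> \<theta>}"
    using closure_subset[of "lopsided_coamoeba c \<alpha>"] by (auto simp: lopsided_coamoeba_def)
  ultimately have "\<theta> \<in> interior {\<theta>. lopsided c \<alpha> \<theta>}"
    by (intro interiorI[of "torus_of -` ?X"] open_torus_of_vimage) auto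
  then show "\<exists>n \<phi>. lifted c \<alpha> n \<phi> \<theta>"
    using assms by (rule interior_lopsided_strict[rotated])
next
  assume "\<exists>n \<phi>. lifted c \<alpha> n \<phi> \<theta>"
  then obtain n \<phi> where \<theta>: "lifted c \<alpha> n \<phi> \<theta>" by blast
  let ?U = "{\<theta>. lifted c \<alpha> n \<phi> \<theta>}"
  have "torus_of ` ?U \<inter> lopsided_coamoeba c \<alpha> = {}"
  proof -
    \<comment> \<open>Another representative of the same torus point need not admit the same lifts,
      but it has the same phases.\<close>
    have "lopsided c \<alpha> \<theta>2" if "lifted c \<alpha> n \<phi> \<theta>1" "torus_of \<theta>1 = torus_of \<theta>2" for \<theta>1 \<theta>2
      using lifted_imp_strict[OF that(1)] phases_torus_of[OF that(2), of c \<alpha>]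
      unfolding lopsided_iff by (metis less_imp_le)
    then show ?thesis
      by (auto simp: lopsided_coamoeba_def)
  qed
  then have "torus_of ` ?U \<inter> closure (lopsided_coamoeba c \<alpha>) = {}"
    using open_Int_closure_eq_empty[OF open_torus_of_image[OF open_lifted]] by blast
  then show "torus_of \<theta> \<in> - closure (lopsided_coamoeba c \<alpha>)"
    using \<theta> by blast
qed


section \<open>Dual matrices and the zonotope\<close>

lemma row_mult_diff: "row_mult (\<lambda>k. x k - y k) B j = row_mult x B j - row_mult y B j"
  by (simp add: row_mult_def left_diff_distrib sum_subtractf)

lemma row_mult_add: "row_mult (\<lambda>k. x k + y k) B j = row_mult x B j + row_mult y B j"
  by (simp add: row_mult_def distrib_right sum.distrib)

lemma row_mult_scale: "row_mult (\<lambda>k. r * x k) B j = r * row_mult x B j"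
  by (simp add: row_mult_def sum_distrib_left mult.assoc)

lemma row_mult_eq_inner: "row_mult x B j = (\<chi> k. x k) \<bullet> real_vec (matrix_column B j)"
  by (simp add: row_mult_def inner_vec_def real_vec_def matrix_column_def)

text \<open>The vectors with entries \<open>u + real_vec (\<alpha> k) \<bullet> w\<close> form the
  row space of A, which AB = 0 annihilates; columns from index \<open>m\<close> on are zero.\<close>

lemma dual_matrix_affine:
  fixes \<alpha> :: "'k::finite \<Rightarrow> int ^ 'n::finite"
  assumes "dual_matrix \<alpha> m B"
  shows "row_mult (\<lambda>k. u + real_vec (\<alpha> k) \<bullet> w) B j = 0"
proof (cases "j < m")
  case True
  then have AB: "exponent_matrix \<alpha> *v matrix_column B j = 0"
    using assms by (simp add: dual_matrix_def)
  have "(exponent_matrix \<alpha> *v matrix_column B j) $ None = 0"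
    by (simp add: AB)
  then have "(\<Sum>k\<in>UNIV. B k j) = 0"
    by (simp add: matrix_vector_mult_def exponent_matrix_def matrix_column_def)
  then have one: "(\<Sum>k\<in>UNIV. real_of_int (B k j)) = 0"
    by (metis of_int_0 of_int_sum)
  have col: "(\<Sum>k\<in>UNIV. real_of_int (\<alpha> k $ i) * real_of_int (B k j)) = 0" for i
  proof -
    have "(exponent_matrix \<alpha> *v matrix_column B j) $ Some i = 0"
      by (simp add: AB)
    then have "(\<Sum>k\<in>UNIV. \<alpha> k $ i * B k j) = 0"
      by (simp add: matrix_vector_mult_def exponent_matrix_def matrix_column_def)
    then have "real_of_int (\<Sum>k\<in>UNIV. \<alpha> k $ i * B k j) = 0"
      by (simp only: of_int_0)
    then show ?thesis by simp
  qed
  have "row_mult (\<lambda>k. u + real_vec (\<alpha> k) \<bullet> w) B j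
    = u * (\<Sum>k\<in>UNIV. real_of_int (B k j))
      + (\<Sum>k\<in>UNIV. \<Sum>i\<in>UNIV. w $ i * (real_of_int (\<alpha> k $ i) * real_of_int (B k j)))"
    by (simp add: row_mult_def inner_vec_def real_vec_def algebra_simps sum.distrib sum_distrib_left)
  also have "(\<Sum>k\<in>UNIV. \<Sum>i\<in>UNIV. w $ i * (real_of_int (\<alpha> k $ i) * real_of_int (B k j)))
    = (\<Sum>i\<in>UNIV. w $ i * (\<Sum>k\<in>UNIV. real_of_int (\<alpha> k $ i) * real_of_int (B k j)))"
    by (subst sum.swap) (simp add: sum_distrib_left)
  finally show ?thesis
    by (simp add: one col)
next
  case False
  then show ?thesis
    using assms by (simp add: dual_matrix_def row_mult_def)
qed

text \<open>This allows the centre \<open>\<phi>\<close>, the base index and the inner products with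
  \<open>\<theta>\<close> to be dropped from a vector before it is multiplied by
  \<open>B\<close>.\<close>

lemma row_mult_eq_mod_affine:
  assumes "dual_matrix \<alpha> m B" and "\<And>k. x k - y k = u + real_vec (\<alpha> k) \<bullet> w"
  shows "row_mult x B = row_mult y B"
proof
  fix j
  have "row_mult (\<lambda>k. x k - y k) B j = 0"
    unfolding assms(2) by (rule dual_matrix_affine[OF assms(1)])
  then show "row_mult x B j = row_mult y B j"
    by (simp add: row_mult_diff)
qed

text \<open>A nonzero \<open>w\<close> would confine all exponents to a hyperplane, of dimension n -
  1. Thus the rows of A are independent.\<close>

lemma affine_function_zero_if_full_dim:
  fixes \<alpha> :: "'k \<Rightarrow> int ^ 'n::finite"
  assumes "aff_dim (newton_polytope \<alpha>) = int CARD('n)"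
    and "\<And>k. u + real_vec (\<alpha> k) \<bullet> w = 0"
  shows "u = 0 \<and> w = 0"
proof -
  have "w = 0"
  proof (rule ccontr)
    assume "w \<noteq> 0"
    have "range (\<lambda>k. real_vec (\<alpha> k)) \<subseteq> {x. w \<bullet> x = - u}"
      using assms(2) by (auto simp: inner_commute eq_neg_iff_add_eq_0 add.commute)
    then have "aff_dim (range (\<lambda>k. real_vec (\<alpha> k))) \<le> aff_dim {x. w \<bullet> x = - u}"
      by (rule aff_dim_subset)
    then show False
      using assms(1) \<open>w \<noteq> 0\<close> by (simp add: newton_polytope_def aff_dim_convex_hull)
  qed
  then show ?thesis using assms(2) by simp
qed

text \<open>The left kernel of \<open>B\<close> contains the row space of \<open>A\<close>, and both have dimension \<open>n + 1\<close>.\<close>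

lemma dual_matrix_left_kernel:
  fixes \<alpha> :: "'k::finite \<Rightarrow> int ^ 'n::finite"
  assumes full: "aff_dim (newton_polytope \<alpha>) = int CARD('n)"
    and m: "m = CARD('k) - CARD('n) - 1"
    and dual: "dual_matrix \<alpha> m B"
    and ker: "\<And>j. row_mult x B j = 0"
  shows "\<exists>u w. \<forall>k. x k = u + real_vec (\<alpha> k) \<bullet> w"
proof -
  define cols where "cols = (\<lambda>j. real_vec (matrix_column B j)) ` {..<m}"
  define L :: "real \<times> (real ^ 'n) \<Rightarrow> real ^ 'k"
    where "L p = (\<chi> k. fst p + real_vec (\<alpha> k) \<bullet> snd p)" for p
  define K where "K = {y \<in> UNIV. \<forall>v \<in> span cols. orthogonal v y}"
  have "linear L"
    by (rule linearI) (simp_all add: L_def vec_eq_iff inner_add_right algebra_simps)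
  have "inj L"
    unfolding linear_injective_0[OF \<open>linear L\<close>]
    using affine_function_zero_if_full_dim[OF full]
    by (auto simp: L_def vec_eq_iff prod_eq_iff)
  then have dimL: "dim (range L) = CARD('n) + 1"
    using dim_image_eq[OF \<open>linear L\<close>, of UNIV] by (simp add: dim_UNIV)
  have "dim cols = m"
    using dual by (simp add: dual_matrix_def cols_def)
  then have "dim K + m = CARD('k)"
    using dim_subspace_orthogonal_to_vectors[of "span cols" UNIV] by (simp add: K_def)
  \<comment> \<open>Since \<open>m\<close> is a truncated difference of naturals, this bound is
    needed to recover n + 1 from N - m.\<close>
  moreover have "CARD('n) + 1 \<le> CARD('k)"
    using dimL dim_subset_UNIV[of "range L"] by simp
  ultimately have dimK: "dim K = CARD('n) + 1"
    using m by simp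
  have in_K: "(\<chi> k. y k) \<in> K" if "\<And>j. row_mult y B j = 0" for y
  proof -
    have "orthogonal (\<chi> k. y k) v" if "v \<in> span cols" for v
      using that by (rule orthogonal_to_span)
        (auto simp: cols_def orthogonal_def \<open>\<And>j. row_mult y B j = 0\<close> simp flip: row_mult_eq_inner)
    then show ?thesis
      by (simp add: K_def orthogonal_commute)
  qed
  have "range L \<subseteq> K"
    unfolding L_def by (auto intro!: in_K dual_matrix_affine[OF dual])
  moreover have "subspace K"
    unfolding K_def by (auto simp: subspace_def orthogonal_clauses)
  ultimately have "range L = K"
    using dimL dimK by (intro subspace_dim_equal linear_subspace_image \<open>linear L\<close>) auto
  then obtain p where "L p = (\<chi> k. x k)"
    using in_K[OF ker] by (metis imageE)
  then show ?thesis
    by (intro exI[of _ "fst p"] exI[of _ "snd p"]) (simp add: L_def vec_eq_iff)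
qed

text \<open>Rank \<open>m\<close> forces the \<open>m\<close> columns to be distinct and
  independent, so they have dual functionals; \<open>adjoint\<close> turns each functional into the
  vector representing it.\<close>

lemma dual_matrix_dual_basis:
  assumes "dual_matrix \<alpha> m B"
  obtains r :: "nat \<Rightarrow> 'k::finite \<Rightarrow> real"
  where "\<And>i j. i < m \<Longrightarrow> j < m \<Longrightarrow> row_mult (r i) B j = (if i = j then 1 else 0)"
proof -
  define col where "col j = real_vec (matrix_column B j)" for j
  have dim: "dim (col ` {..<m}) = m"
    using assms by (simp add: dual_matrix_def col_def)
  have card: "card (col ` {..<m}) = m"
    using dim dim_le_card'[of "col ` {..<m}"] card_image_le[of "{..<m}" col] by simp
  then have inj: "inj_on col {..<m}"
    by (simp add: eq_card_imp_inj_on)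
  have indep: "independent (col ` {..<m})"
    using dim card by (intro card_le_dim_spanning[of _ "span (col ` {..<m})"]) (auto simp: span_superset)
  have "\<exists>r::'k \<Rightarrow> real. \<forall>j<m. row_mult r B j = (if i = j then 1 else 0)" if "i < m" for i
  proof -
    obtain g :: "real ^ 'k \<Rightarrow> real" where g: "linear g"
      "\<forall>v\<in>col ` {..<m}. g v = (if v = col i then 1 else 0)"
      using linear_independent_extend[OF indep, of "\<lambda>v. if v = col i then 1 else 0"] by (elim exE conjE)
    have "row_mult (\<lambda>k. adjoint g 1 $ k) B j = (if i = j then 1 else 0)" if "j < m" for j
    proof -
      have "row_mult (\<lambda>k. adjoint g 1 $ k) B j = g (col j)"
        using adjoint_works[OF g(1), of "col j" 1]
        by (simp add: row_mult_eq_inner col_def inner_commute)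
      then show ?thesis
        using g(2) inj that \<open>i < m\<close> by (auto dest: inj_onD)
    qed
    then show ?thesis by blast
  qed
  then have "\<forall>i. \<exists>r::'k \<Rightarrow> real. i < m \<longrightarrow> (\<forall>j<m. row_mult r B j = (if i = j then 1 else 0))"
    by simp
  from choice[OF this] show ?thesis
    using that by blast
qed

text \<open>The dual vectors \<open>r i\<close> give a continuous affine section \<open>s\<close> of
  the map x to xB with s(v) = t. Points of the space near v therefore still have preimages in the
  open cube.\<close>

lemma row_mult_in_interior_zonotope:
  fixes t :: "'k::finite \<Rightarrow> real"
  assumes dual: "dual_matrix \<alpha> m B" and t: "\<And>k. \<bar>t k\<bar> < pi / 2"
  shows "row_mult t B \<in> Euclidean_space m interior_of zonotope B"
proof -
  obtain r :: "nat \<Rightarrow> 'k \<Rightarrow> real"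
    where r: "\<And>i j. i < m \<Longrightarrow> j < m \<Longrightarrow> row_mult (r i) B j = (if i = j then 1 else 0)"
    using dual_matrix_dual_basis[OF dual] by metis
  have B0: "row_mult x B j = 0" if "j \<ge> m" for x j
    using dual that by (simp add: dual_matrix_def row_mult_def)
  define v where "v = row_mult t B"
  define s where "s y k = t k + (\<Sum>i<m. (y i - v i) * r i k)" for y k
  define U where "U = {y. \<forall>k. \<bar>s y k\<bar> < pi / 2}"
  have "U = (\<Inter>k. {y. \<bar>s y k\<bar> < pi / 2})"
    by (auto simp: U_def)
  also have "open \<dots>"
    unfolding s_def by (intro open_INT ballI finite open_Collect_less continuous_intros
        continuous_on_product_coordinates)
  finally have "open U" .
  have "row_mult (s y) B = y" if "y \<in> topspace (Euclidean_space m)" for y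
  proof
    fix j
    show "row_mult (s y) B j = y j"
    proof (cases "j < m")
      case True
      have "row_mult (s y) B j = v j + (\<Sum>i<m. (y i - v i) * row_mult (r i) B j)"
        unfolding s_def row_mult_add v_def
        by (simp add: row_mult_def sum_distrib_left sum_distrib_right mult.assoc)
          (rule sum.swap)
      also have "\<dots> = v j + (\<Sum>i<m. if i = j then y i - v i else 0)"
        using True by (intro arg_cong2[of _ _ _ _ "(+)"] sum.cong) (auto simp: r)
      finally show ?thesis using True by simp
    next
      case False
      then show ?thesis
        using that by (simp add: B0 topspace_Euclidean_space)
    qed
  qed
  moreover have "row_mult (s y) B \<in> zonotope B" if "y \<in> U" for y
  proof -
    have "\<bar>2 / pi * s y k\<bar> \<le> 1" for k
      using that by (auto simp: U_def abs_mult field_simps less_imp_le)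
    then show ?thesis
      unfolding zonotope_def by (intro CollectI exI[of _ "\<lambda>k. 2 / pi * s y k"]) simp
  qed
  ultimately have "topspace (Euclidean_space m) \<inter> U \<subseteq> zonotope B"
    by (metis IntE subsetI)
  moreover have "openin (Euclidean_space m) (topspace (Euclidean_space m) \<inter> U)"
    using \<open>open U\<close> unfolding Euclidean_space_def euclidean_product_topology
    by (simp add: openin_open_Int)
  moreover have "v \<in> topspace (Euclidean_space m) \<inter> U"
    using t by (simp add: U_def s_def topspace_Euclidean_space v_def B0)
  ultimately show ?thesis
    unfolding interior_of_def v_def by blast
qed

text \<open>An interior point stays in the zonotope when scaled by some \<open>1 + e > 1\<close>; scaling back shrinks
  the coordinates.\<close>

lemma interior_zonotopeD:
  fixes B :: "'k::finite \<Rightarrow> nat \<Rightarrow> int"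
  assumes "v \<in> Euclidean_space m interior_of zonotope B"
  obtains t where "\<And>k. \<bar>t k\<bar> < pi / 2" "v = row_mult t B"
proof -
  obtain T where T: "openin (Euclidean_space m) T" "v \<in> T" "T \<subseteq> zonotope B"
    using assms by (auto simp: interior_of_def)
  then obtain V where V: "open V" "T = {x. \<forall>i\<ge>m. x i = 0} \<inter> V"
    unfolding Euclidean_space_def euclidean_product_topology by (auto simp: openin_open)
  have "((\<lambda>e j. (1 + e) * v j) \<longlongrightarrow> v) (at_right (0::real))"
  proof -
    have "continuous_on UNIV (\<lambda>(e::real) j. (1 + e) * v j)"
      by (intro continuous_on_coordinatewise_then_product continuous_intros)
    then have "isCont (\<lambda>e j. (1 + e) * v j) (0::real)"
      by (simp add: continuous_on_eq_continuous_at)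
    then show ?thesis
      by (auto simp: isCont_def intro: filterlim_mono[OF _ order_refl at_le])
  qed
  then have "\<forall>\<^sub>F e in at_right (0::real). (\<lambda>j. (1 + e) * v j) \<in> V"
    using V T(2) by (auto intro: topological_tendstoD)
  moreover have "\<forall>\<^sub>F e in at_right (0::real). 0 < e"
    by (rule eventually_at_right_less)
  ultimately have "\<forall>\<^sub>F e in at_right (0::real). (\<lambda>j. (1 + e) * v j) \<in> V \<and> 0 < e"
    by (rule eventually_conj)
  then obtain e :: real where e: "(\<lambda>j. (1 + e) * v j) \<in> V" "e > 0"
    using eventually_happens' trivial_limit_at_right_real by blast
  \<comment> \<open>Scaling preserves the vanishing of the coordinates from index \<open>m\<close>
    on, so the scaled point lies in \<open>T\<close>.\<close>
  then have "(\<lambda>j. (1 + e) * v j) \<in> zonotope B"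
    using T V by auto
  then obtain \<mu> where \<mu>: "(\<lambda>j. (1 + e) * v j) = row_mult (\<lambda>k. pi / 2 * \<mu> k) B" "\<And>k. \<bar>\<mu> k\<bar> \<le> 1"
    by (auto simp: zonotope_def)
  have "\<bar>1 / (1 + e) * (pi / 2 * \<mu> k)\<bar> < pi / 2" for k
  proof -
    have "\<bar>\<mu> k\<bar> < 1 + e"
      using \<mu>(2)[of k] e(2) by linarith
    then have "pi * \<bar>\<mu> k\<bar> < pi * (1 + e)"
      by (rule mult_strict_left_mono) simp
    then show ?thesis
      using e(2) by (simp add: abs_mult field_simps)
  qed
  moreover have "v = row_mult (\<lambda>k. 1 / (1 + e) * (pi / 2 * \<mu> k)) B"
  proof
    fix j
    show "v j = row_mult (\<lambda>k. 1 / (1 + e) * (pi / 2 * \<mu> k)) B j"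
      using e(2) fun_cong[OF \<mu>(1), of j] unfolding row_mult_scale by (simp add: field_simps)
  qed
  ultimately show ?thesis by (rule that)
qed


section \<open>The order map\<close>

text \<open>Two offsets below pi/2 in absolute value differ by less than pi, so
  \<open>s k - s a\<close> is already a principal argument. Hence \<open>p_coord\<close> equals 2 pi
  times \<open>n k - n a\<close>, and the constant part in \<open>n a\<close> is killed by
  \<open>B\<close>.\<close>

lemma v_map_lifted:
  fixes c :: "'k::finite \<Rightarrow> complex" and \<alpha> :: "'k \<Rightarrow> int ^ 'n::finite"
  assumes c: "\<And>k. c k \<noteq> 0" and dual: "dual_matrix \<alpha> m B" and lift: "lifted c \<alpha> n \<phi> \<theta>"
  shows "v_map c \<alpha> B a \<theta> = row_mult (\<lambda>k. Arg (c k) + 2 * pi * of_int (n k)) B"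
proof -
  define s where "s k = Arg (c k) + real_vec (\<alpha> k) \<bullet> \<theta> + 2 * pi * of_int (n k) - \<phi>" for k
  have s: "\<bar>s k\<bar> < pi / 2" for k
    using lift by (simp add: lifted_def s_def)
  have sgn: "sgn (c k * cis (real_vec (\<alpha> k) \<bullet> \<theta>)) = cis (s k) * cis \<phi>" for k
  proof -
    have "s k + \<phi> = Arg (c k) + real_vec (\<alpha> k) \<bullet> \<theta> + 2 * pi * of_int (n k)"
      by (simp add: s_def)
    then have "cis (s k) * cis \<phi> = cis (Arg (c k)) * cis (real_vec (\<alpha> k) \<bullet> \<theta>)"
      by (simp add: cis_mult) (simp add: cis_multiple_2pi flip: cis_mult)
    then show ?thesis
      using c by (simp add: cis_Arg sgn_mult)
  qed
  have "Arg ((c k * cis (real_vec (\<alpha> k) \<bullet> \<theta>)) / (c a * cis (real_vec (\<alpha> a) \<bullet> \<theta>))) = s k - s a" for k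
  proof (rule cis_Arg_unique)
    show "sgn (c k * cis (real_vec (\<alpha> k) \<bullet> \<theta>) / (c a * cis (real_vec (\<alpha> a) \<bullet> \<theta>))) = cis (s k - s a)"
      unfolding sgn_divide sgn by (simp flip: cis_divide)
    show "- pi < s k - s a" "s k - s a \<le> pi"
      using s[of k] s[of a] by linarith+
  qed
  then have "p_coord c \<alpha> a \<theta> k = 2 * pi * of_int (n k) - 2 * pi * of_int (n a)" for k
    by (simp add: p_coord_def s_def inner_diff_left real_vec_def inner_vec_def left_diff_distrib sum_subtractf)
  then show ?thesis
    unfolding v_map_def
    by (intro row_mult_eq_mod_affine[OF dual, of _ _ "- 2 * pi * of_int (n a)" 0]) simp
qed

text \<open>A change of representative by 2 pi z replaces \<open>n k\<close> by
  \<open>n k - d k\<close>, where \<open>d k\<close> is the inner product of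
  \<open>\<alpha> k\<close> with z; the vector \<open>d\<close> lies in the row space of A.\<close>

lemma v_map_torus_lifted:
  fixes c :: "'k::finite \<Rightarrow> complex" and \<alpha> :: "'k \<Rightarrow> int ^ 'n::finite"
  assumes c: "\<And>k. c k \<noteq> 0" and dual: "dual_matrix \<alpha> m B" and lift: "lifted c \<alpha> n \<phi> \<theta>"
    and eq: "torus_of \<theta>' = torus_of \<theta>"
  shows "v_map c \<alpha> B a \<theta>' = row_mult (\<lambda>k. Arg (c k) + 2 * pi * of_int (n k)) B"
proof -
  obtain z where z: "\<theta>' = \<theta> + (2 * pi) *\<^sub>R real_vec z"
    using torus_of_eqD[OF eq] .
  define d where "d k = (\<Sum>i\<in>UNIV. \<alpha> k $ i * z $ i)" for k
  have d: "real_vec (\<alpha> k) \<bullet> real_vec z = of_int (d k)" for k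
    by (simp only: inner_real_vec d_def)
  have "lifted c \<alpha> (\<lambda>k. n k - d k) \<phi> \<theta>'"
    using lift by (simp add: lifted_def z inner_add_right d algebra_simps)
  then have "v_map c \<alpha> B a \<theta>' = row_mult (\<lambda>k. Arg (c k) + 2 * pi * of_int (n k - d k)) B"
    by (rule v_map_lifted[OF c dual])
  also have "\<dots> = row_mult (\<lambda>k. Arg (c k) + 2 * pi * of_int (n k)) B"
    by (rule row_mult_eq_mod_affine[OF dual, of _ _ 0 "- (2 * pi) *\<^sub>R real_vec z"])
      (simp add: d algebra_simps)
  finally show ?thesis .
qed

text \<open>Lifts valid at one point are valid nearby, so the order value is locally constant;
  connectedness makes it constant. The relation \<open>R\<close> ranges over all representatives and
  base indices, which gives independence of these choices as well.\<close>

lemma v_map_constant_on_connected: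
  fixes c :: "'k::finite \<Rightarrow> complex" and \<alpha> :: "'k \<Rightarrow> int ^ 'n::finite"
  assumes c: "\<And>k. c k \<noteq> 0" and inj: "inj \<alpha>" and dual: "dual_matrix \<alpha> m B"
    and conn: "connected \<Theta>" and sub: "\<Theta> \<subseteq> - closure (lopsided_coamoeba c \<alpha>)"
    and \<theta>: "torus_of \<theta> \<in> \<Theta>" "torus_of \<theta>' \<in> \<Theta>"
  shows "v_map c \<alpha> B a \<theta> = v_map c \<alpha> B a' \<theta>'"
proof -
  define R where "R x y \<longleftrightarrow> (\<forall>\<theta> \<theta>' a a'. torus_of \<theta> = x \<longrightarrow> torus_of \<theta>' = y \<longrightarrow>
    v_map c \<alpha> B a \<theta> = v_map c \<alpha> B a' \<theta>')" for x y
  have "R (torus_of \<theta>) (torus_of \<theta>')"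
  proof (rule connected_equivalence_relation[OF conn \<theta>])
    show "R y x" if "R x y" for x y
      using that unfolding R_def by metis
    show "R x z" if "R x y" "R y z" for x y z
      using that surj_torus_of[of y] unfolding R_def by metis
    show "\<exists>T. openin (top_of_set \<Theta>) T \<and> x \<in> T \<and> (\<forall>y\<in>T. R x y)" if x: "x \<in> \<Theta>" for x
    proof -
      obtain \<theta>0 where \<theta>0: "torus_of \<theta>0 = x" by (rule surj_torus_of)
      then obtain n \<phi> where lift: "lifted c \<alpha> n \<phi> \<theta>0"
        using complement_closure_lopsided_coamoeba_iff[OF inj, of \<theta>0 c] x sub by auto
      let ?T = "\<Theta> \<inter> torus_of ` {\<theta>. lifted c \<alpha> n \<phi> \<theta>}"
      have "openin (top_of_set \<Theta>) ?T"
        by (intro openin_open_Int open_torus_of_image open_lifted)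
      moreover have "x \<in> ?T"
        using x \<theta>0 lift by blast
      moreover have "R x y" if "y \<in> ?T" for y
        using that \<theta>0 lift v_map_torus_lifted[OF c dual] unfolding R_def by auto
      ultimately show ?thesis by blast
    qed
  qed
  then show ?thesis by (simp add: R_def)
qed

lemma co_ord_lifted:
  fixes c :: "'k::finite \<Rightarrow> complex" and \<alpha> :: "'k \<Rightarrow> int ^ 'n::finite"
  assumes c: "\<And>k. c k \<noteq> 0" and inj: "inj \<alpha>" and dual: "dual_matrix \<alpha> m B"
    and \<Theta>: "\<Theta> \<in> CC c \<alpha>" "torus_of \<theta> \<in> \<Theta>" and lift: "lifted c \<alpha> n \<phi> \<theta>"
  shows "co_ord c \<alpha> B \<Theta> = row_mult (\<lambda>k. Arg (c k) + 2 * pi * of_int (n k)) B"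
  unfolding co_ord_def
proof (rule the_equality)
  have "connected \<Theta>" "\<Theta> \<subseteq> - closure (lopsided_coamoeba c \<alpha>)"
    using \<Theta>(1) unfolding CC_def by (auto dest: in_components_connected in_components_subset)
  then have "v_map c \<alpha> B a \<theta>' = v_map c \<alpha> B a \<theta>" if "torus_of \<theta>' \<in> \<Theta>" for \<theta>' a
    using v_map_constant_on_connected[where c = c, OF c inj dual] \<Theta>(2) that by blast
  then show "\<forall>\<theta> a. torus_of \<theta> \<in> \<Theta> \<longrightarrow>
      v_map c \<alpha> B a \<theta> = row_mult (\<lambda>k. Arg (c k) + 2 * pi * of_int (n k)) B"
    by (simp add: v_map_lifted[OF c dual lift])
next
  fix v assume "\<forall>\<theta> a. torus_of \<theta> \<in> \<Theta> \<longrightarrow> v_map c \<alpha> B a \<theta> = v"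
  then show "v = row_mult (\<lambda>k. Arg (c k) + 2 * pi * of_int (n k)) B"
    using \<Theta>(2) v_map_lifted[OF c dual lift] by auto
qed

theorem proposition4p6:
  fixes c :: "'k::finite \<Rightarrow> complex"
    and \<alpha> :: "'k \<Rightarrow> int ^ 'n::finite"
    and B :: "'k \<Rightarrow> nat \<Rightarrow> int"
    and m :: nat
  assumes "\<And>k. c k \<noteq> 0"
    and "inj \<alpha>"
    and "aff_dim (newton_polytope \<alpha>) = int CARD('n)"
    and "m = CARD('k) - CARD('n) - 1"
    and "dual_matrix \<alpha> m B"
  shows "co_ord c \<alpha> B ` CC c \<alpha> = order_target c m B"
proof (intro equalityI subsetI)
  note mem_iff = complement_closure_lopsided_coamoeba_iff[OF assms(2)]
  note co_ord = co_ord_lifted[OF assms(1,2,5)]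
  \<comment> \<open>The integers of a lift become the coefficients of a point of the row lattice,
    which places the value in the translated lattice.\<close>
  have split: "row_mult (\<lambda>k. Arg (c k) + 2 * pi * of_int (l k)) B
      = (\<lambda>j. row_mult (\<lambda>k. Arg (c k)) B j + 2 * pi * row_mult (\<lambda>k. of_int (l k)) B j)" for l
    by (simp add: fun_eq_iff row_mult_add row_mult_scale)
  {
    fix v assume "v \<in> co_ord c \<alpha> B ` CC c \<alpha>"
    then obtain \<Theta> where \<Theta>: "\<Theta> \<in> CC c \<alpha>" "v = co_ord c \<alpha> B \<Theta>" by blast
    then obtain x where x: "x \<in> \<Theta>"
      using in_components_nonempty unfolding CC_def by blast
    obtain \<theta> where \<theta>: "torus_of \<theta> = x" by (rule surj_torus_of)
    have "torus_of \<theta> \<in> - closure (lopsided_coamoeba c \<alpha>)"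
      using \<Theta>(1) x \<theta> in_components_subset unfolding CC_def by blast
    then obtain n \<phi> where lift: "lifted c \<alpha> n \<phi> \<theta>"
      using mem_iff by blast
    have v: "v = row_mult (\<lambda>k. Arg (c k) + 2 * pi * of_int (n k)) B"
      using co_ord[OF \<Theta>(1) _ lift] \<Theta>(2) x \<theta> by simp
    \<comment> \<open>Adding an element of the row space of A replaces the lifts by their offsets
      from \<open>\<phi>\<close>, a point of the open cube.\<close>
    also have "\<dots> = row_mult (\<lambda>k. Arg (c k) + real_vec (\<alpha> k) \<bullet> \<theta> + 2 * pi * of_int (n k) - \<phi>) B"
      by (rule row_mult_eq_mod_affine[OF assms(5), of _ _ \<phi> "- \<theta>"]) simp
    also have "\<dots> \<in> Euclidean_space m interior_of zonotope B"
      using lift by (intro row_mult_in_interior_zonotope[OF assms(5)]) (simp add: lifted_def)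
    finally show "v \<in> order_target c m B"
      unfolding order_target_def row_lattice_def using v split by auto
  next
    fix v assume v: "v \<in> order_target c m B"
    then obtain t where t: "\<And>k. \<bar>t k\<bar> < pi / 2" "v = row_mult t B"
      using interior_zonotopeD unfolding order_target_def by blast
    obtain l where l: "v = row_mult (\<lambda>k. Arg (c k) + 2 * pi * of_int (l k)) B"
      using v unfolding split order_target_def row_lattice_def by blast
    have ker: "row_mult (\<lambda>k. (Arg (c k) + 2 * pi * of_int (l k)) - t k) B j = 0" for j
      by (simp only: row_mult_diff flip: l t(2))
    \<comment> \<open>Here \<open>u\<close> will be the centre of the half-plane and
      \<open>- w\<close> the point whose component has order \<open>v\<close>.\<close>
    obtain u w where uw: "\<forall>k. (Arg (c k) + 2 * pi * of_int (l k)) - t k = u + real_vec (\<alpha> k) \<bullet> w"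
      using dual_matrix_left_kernel[OF assms(3,4,5) ker] by (elim exE)
    have "Arg (c k) + real_vec (\<alpha> k) \<bullet> (- w) + 2 * pi * of_int (l k) - u = t k" for k
      using uw[rule_format, of k] by simp
    then have lift: "lifted c \<alpha> l u (- w)"
      using t(1) by (simp add: lifted_def)
    let ?X = "- closure (lopsided_coamoeba c \<alpha>)"
    let ?\<Theta> = "connected_component_set ?X (torus_of (- w))"
    have "torus_of (- w) \<in> ?X"
      using mem_iff lift by blast
    then have "?\<Theta> \<in> CC c \<alpha>" "torus_of (- w) \<in> ?\<Theta>"
      unfolding CC_def by (auto intro: componentsI)
    then show "v \<in> co_ord c \<alpha> B ` CC c \<alpha>"
      using co_ord[OF _ _ lift] l by (intro image_eqI[of _ _ ?\<Theta>]) auto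
  }
qed

end
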